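(* Let $G$ be a finite group such that $H^2(G,\mathbb{C}^\times)$ is trivial. Then the irreducible quandle representations of $Conj(G)$ over $\mathbb{C}$ are exactly the products $\chi\cdot\rho'$, where $\chi$ is a character of the quandle $Conj(G)$ and $\rho'$ is an irreducible complex linear representation of the group $G$ (viewed as a quandle representation of $Conj(G)$).
   Context: For a group $G$, $Conj(G)$ is the quandle with underlying set $G$ and operation $x\triangleright y=xyx^{-1}$. A quandle representation of a quandle $Q$ on a complex vector space $V$ is a map $\rho:Q\to GL(V)$ with $\rho(x\triangleright y)=\rho(x)\rho(y)\rho(x)^{-1}$ for all $x,y\in Q$. A subrepresentation is a subspace $W\subset V$ with $\rho(x)(W)\subset W$ for all $x\in Q$; $\rho$ is irreducible if $V\neq 0$ and its only subrepresentations are $0$ and $V$. A character of a quandle $Q$ is a map $\chi:Q\to\mathbb{C}^\times$ with $\chi(x\triangleright y)=\chi(y)$ for all $x,y\in Q$; for a quandle representation $\rho$, $(\chi\cdot\rho)(x)=\chi(x)\rho(x)$. A group representation of $G$ is in particular a quandle representation of $Conj(G)$. $H^2(G,\mathbb{C}^\times)$ (the Schur multiplier of $G$) denotes group cohomology with trivial action on $\mathbb{C}^\times$. *)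

theory Defs
  imports Complex_Main "HOL-Algebra.Product_Groups"
begin

section \<open>Quandles and their representations\<close>

record 'a quandle = "'a partial_object" +
  qop :: "'a \<Rightarrow> 'a \<Rightarrow> 'a"  (infixl \<open>\<triangleright>\<index>\<close> 70)

text \<open>The left translations \<open>y \<mapsto> x \<triangleright> y\<close> are the permutations of the quandle.\<close>

locale quandle =
  fixes Q (structure)
  assumes qop_closed: "\<lbrakk>x \<in> carrier Q; y \<in> carrier Q\<rbrakk> \<Longrightarrow> x \<triangleright> y \<in> carrier Q"
    and qop_idem: "x \<in> carrier Q \<Longrightarrow> x \<triangleright> x = x"
    and qop_bij: "x \<in> carrier Q \<Longrightarrow> bij_betw (\<lambda>y. x \<triangleright> y) (carrier Q) (carrier Q)"
    and qop_distrib: "\<lbrakk>x \<in> carrier Q; y \<in> carrier Q; z \<in> carrier Q\<rbrakk>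
          \<Longrightarrow> x \<triangleright> (y \<triangleright> z) = (x \<triangleright> y) \<triangleright> (x \<triangleright> z)"

definition Conj :: "('a, 'm) monoid_scheme \<Rightarrow> 'a quandle" where
  "Conj G = \<lparr>carrier = carrier G, qop = (\<lambda>x y. x \<otimes>\<^bsub>G\<^esub> y \<otimes>\<^bsub>G\<^esub> inv\<^bsub>G\<^esub> x)\<rparr>"

text \<open>A complex vector space is a type \<open>'v\<close> together with a scalar multiplication satisfying
  the library's \<^locale>\<open>vector_space\<close>; its dimension may be infinite.\<close>

definition GL :: "(complex \<Rightarrow> 'v \<Rightarrow> 'v) \<Rightarrow> ('v::ab_group_add \<Rightarrow> 'v) monoid" where
  "GL scale = \<lparr>carrier = {f. Vector_Spaces.linear scale scale f \<and> bij f},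
               monoid.mult = (\<circ>), one = id\<rparr>"

locale quandle_representation = quandle Q + vector_space scale
  for Q :: "('q, 'm) quandle_scheme" (structure)
    and scale :: "complex \<Rightarrow> 'v::ab_group_add \<Rightarrow> 'v"
    and \<rho> :: "'q \<Rightarrow> 'v \<Rightarrow> 'v" +
  assumes rep_closed: "x \<in> carrier Q \<Longrightarrow> \<rho> x \<in> carrier (GL scale)"
    and rep_qop: "\<lbrakk>x \<in> carrier Q; y \<in> carrier Q\<rbrakk>
          \<Longrightarrow> \<rho> (x \<triangleright> y) = \<rho> x \<otimes>\<^bsub>GL scale\<^esub> \<rho> y \<otimes>\<^bsub>GL scale\<^esub> inv\<^bsub>GL scale\<^esub> (\<rho> x)"

locale group_representation = group G + vector_space scale
  for G :: "('g, 'm) monoid_scheme" (structure)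
    and scale :: "complex \<Rightarrow> 'v::ab_group_add \<Rightarrow> 'v"
    and \<rho> :: "'g \<Rightarrow> 'v \<Rightarrow> 'v" +
  assumes rep_hom: "\<rho> \<in> hom G (GL scale)"

definition subrepresentation ::
  "'x set \<Rightarrow> (complex \<Rightarrow> 'v \<Rightarrow> 'v::ab_group_add) \<Rightarrow> ('x \<Rightarrow> 'v \<Rightarrow> 'v) \<Rightarrow> 'v set \<Rightarrow> bool" where
  "subrepresentation X scale \<rho> W \<longleftrightarrow>
     Modules.module.subspace scale W \<and> (\<forall>x\<in>X. \<rho> x ` W \<subseteq> W)"

locale irreducible_quandle_representation = quandle_representation Q scale \<rho>
  for Q :: "('q, 'm) quandle_scheme" (structure)
    and scale :: "complex \<Rightarrow> 'v::ab_group_add \<Rightarrow> 'v"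
    and \<rho> :: "'q \<Rightarrow> 'v \<Rightarrow> 'v" +
  assumes nonzero: "(UNIV :: 'v set) \<noteq> {0}"
    and irreducible: "subrepresentation (carrier Q) scale \<rho> W \<Longrightarrow> W = {0} \<or> W = UNIV"

locale irreducible_group_representation = group_representation G scale \<rho>
  for G :: "('g, 'm) monoid_scheme" (structure)
    and scale :: "complex \<Rightarrow> 'v::ab_group_add \<Rightarrow> 'v"
    and \<rho> :: "'g \<Rightarrow> 'v \<Rightarrow> 'v" +
  assumes nonzero: "(UNIV :: 'v set) \<noteq> {0}"
    and irreducible: "subrepresentation (carrier G) scale \<rho> W \<Longrightarrow> W = {0} \<or> W = UNIV"

definition quandle_character :: "('q, 'm) quandle_scheme \<Rightarrow> ('q \<Rightarrow> complex) \<Rightarrow> bool" where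
  "quandle_character Q \<chi> \<longleftrightarrow>
     (\<forall>x\<in>carrier Q. \<chi> x \<noteq> 0) \<and>
     (\<forall>x\<in>carrier Q. \<forall>y\<in>carrier Q. \<chi> (x \<triangleright>\<^bsub>Q\<^esub> y) = \<chi> y)"

definition twist :: "(complex \<Rightarrow> 'v \<Rightarrow> 'v) \<Rightarrow> ('q \<Rightarrow> complex) \<Rightarrow> ('q \<Rightarrow> 'v \<Rightarrow> 'v) \<Rightarrow> 'q \<Rightarrow> 'v \<Rightarrow> 'v" where
  "twist scale \<chi> \<rho> = (\<lambda>x v. scale (\<chi> x) (\<rho> x v))"

section \<open>Second group cohomology with trivial action\<close>

text \<open>Inhomogeneous cochains of \<open>G\<close> with values in an abelian group \<open>A\<close> on which \<open>G\<close> acts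
  trivially. The group operation of \<open>A\<close> is written multiplicatively, so that the alternating sums
  in the differentials become products with alternating inverses. Cochains are extensional
  functions, so equality of cochains is equality on the carrier.\<close>

definition cochains1 :: "('g, 'm) monoid_scheme \<Rightarrow> ('a, 'n) monoid_scheme \<Rightarrow> ('g \<Rightarrow> 'a) monoid" where
  "cochains1 G A = product_group (carrier G) (\<lambda>_. A)"

definition cochains2 ::
  "('g, 'm) monoid_scheme \<Rightarrow> ('a, 'n) monoid_scheme \<Rightarrow> ('g \<times> 'g \<Rightarrow> 'a) monoid" where
  "cochains2 G A = product_group (carrier G \<times> carrier G) (\<lambda>_. A)"

definition cochains3 ::
  "('g, 'm) monoid_scheme \<Rightarrow> ('a, 'n) monoid_scheme \<Rightarrow> ('g \<times> 'g \<times> 'g \<Rightarrow> 'a) monoid" where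
  "cochains3 G A = product_group (carrier G \<times> carrier G \<times> carrier G) (\<lambda>_. A)"

definition diff1 ::
  "('g, 'm) monoid_scheme \<Rightarrow> ('a, 'n) monoid_scheme \<Rightarrow> ('g \<Rightarrow> 'a) \<Rightarrow> ('g \<times> 'g \<Rightarrow> 'a)" where
  "diff1 G A f = (\<lambda>(x, y) \<in> carrier G \<times> carrier G.
     f y \<otimes>\<^bsub>A\<^esub> inv\<^bsub>A\<^esub> f (x \<otimes>\<^bsub>G\<^esub> y) \<otimes>\<^bsub>A\<^esub> f x)"

definition diff2 ::
  "('g, 'm) monoid_scheme \<Rightarrow> ('a, 'n) monoid_scheme \<Rightarrow> ('g \<times> 'g \<Rightarrow> 'a) \<Rightarrow> ('g \<times> 'g \<times> 'g \<Rightarrow> 'a)" where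
  "diff2 G A f = (\<lambda>(x, y, z) \<in> carrier G \<times> carrier G \<times> carrier G.
     f (y, z) \<otimes>\<^bsub>A\<^esub> inv\<^bsub>A\<^esub> f (x \<otimes>\<^bsub>G\<^esub> y, z) \<otimes>\<^bsub>A\<^esub> f (x, y \<otimes>\<^bsub>G\<^esub> z) \<otimes>\<^bsub>A\<^esub> inv\<^bsub>A\<^esub> f (x, y))"

definition cocycles2 ::
  "('g, 'm) monoid_scheme \<Rightarrow> ('a, 'n) monoid_scheme \<Rightarrow> ('g \<times> 'g \<Rightarrow> 'a) monoid" where
  "cocycles2 G A =
     (cochains2 G A)\<lparr>carrier := kernel (cochains2 G A) (cochains3 G A) (diff2 G A)\<rparr>"

definition coboundaries2 ::
  "('g, 'm) monoid_scheme \<Rightarrow> ('a, 'n) monoid_scheme \<Rightarrow> ('g \<times> 'g \<Rightarrow> 'a) set" where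
  "coboundaries2 G A = diff1 G A ` carrier (cochains1 G A)"

definition H2 ::
  "('g, 'm) monoid_scheme \<Rightarrow> ('a, 'n) monoid_scheme \<Rightarrow> ('g \<times> 'g \<Rightarrow> 'a) set monoid" where
  "H2 G A = cocycles2 G A Mod coboundaries2 G A"

definition complex_mult_group :: "complex monoid" where
  "complex_mult_group = \<lparr>carrier = UNIV - {0}, monoid.mult = (*), one = 1\<rparr>"

section \<open>The constructions are well defined\<close>

lemma (in group) quandle_Conj: "quandle (Conj G)"
proof
  fix x assume x: "x \<in> carrier (Conj G)"
  have a: "inv x \<otimes> (x \<otimes> w) = w" "x \<otimes> (inv x \<otimes> w) = w" if "w \<in> carrier G" for w
    using x that by (simp_all add: Conj_def flip: m_assoc)
  show "bij_betw (\<lambda>y. x \<triangleright>\<^bsub>Conj G\<^esub> y) (carrier (Conj G)) (carrier (Conj G))"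
    using x by (intro bij_betwI[where g = "\<lambda>y. inv x \<otimes> y \<otimes> x"])
      (auto simp: Conj_def m_assoc a)
  show "x \<triangleright>\<^bsub>Conj G\<^esub> x = x"
    using x by (simp add: Conj_def m_assoc)
  fix y assume y: "y \<in> carrier (Conj G)"
  show "x \<triangleright>\<^bsub>Conj G\<^esub> y \<in> carrier (Conj G)"
    using x y by (simp add: Conj_def)
  fix z assume z: "z \<in> carrier (Conj G)"
  show "x \<triangleright>\<^bsub>Conj G\<^esub> (y \<triangleright>\<^bsub>Conj G\<^esub> z) =
      (x \<triangleright>\<^bsub>Conj G\<^esub> y) \<triangleright>\<^bsub>Conj G\<^esub> (x \<triangleright>\<^bsub>Conj G\<^esub> z)"
    using x y z by (simp add: Conj_def m_assoc inv_mult_group a)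
qed

lemma group_GL:
  assumes "vector_space scale"
  shows "group (GL scale)"
proof (rule groupI)
  interpret vector_space scale by fact
  fix f assume f: "f \<in> carrier (GL scale)"
  then interpret f: Vector_Spaces.linear scale scale f by (simp add: GL_def)
  have bf: "bij f" using f by (simp add: GL_def)
  have "Vector_Spaces.linear scale scale (inv_into UNIV f)"
  proof unfold_locales
    fix a b c
    have *: "f (inv_into UNIV f u) = u" for u
      using bf by (simp add: bij_is_surj surj_f_inv_f)
    have inj: "u = v" if "f u = f v" for u v
      using bf that by (meson bij_is_inj injD)
    show "inv_into UNIV f (a + b) = inv_into UNIV f a + inv_into UNIV f b"
      by (rule inj) (simp add: * f.add)
    show "inv_into UNIV f (scale c b) = scale c (inv_into UNIV f b)"
      by (rule inj) (simp add: * f.scale)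
  qed
  then show "\<exists>g\<in>carrier (GL scale). g \<otimes>\<^bsub>GL scale\<^esub> f = \<one>\<^bsub>GL scale\<^esub>"
    using bf by (intro bexI[of _ "inv_into UNIV f"])
      (auto simp: GL_def bij_imp_bij_inv bij_is_inj)
qed (use assms in \<open>auto simp: GL_def vector_space.linear_id bij_comp o_assoc
      intro: Vector_Spaces.linear_compose\<close>)

lemma comm_group_complex_mult_group: "comm_group complex_mult_group"
proof (rule comm_groupI)
  fix x assume "x \<in> carrier complex_mult_group"
  then show "\<exists>y\<in>carrier complex_mult_group. y \<otimes>\<^bsub>complex_mult_group\<^esub> x = \<one>\<^bsub>complex_mult_group\<^esub>"
    by (intro bexI[of _ "inverse x"]) (auto simp: complex_mult_group_def)
qed (auto simp: complex_mult_group_def)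

lemma group_H2:
  assumes "group G" and "comm_group A"
  shows "group (H2 G A)"
proof -
  interpret G: group G by fact
  interpret A: comm_group A by fact
  have comm: "comm_group (product_group I (\<lambda>_. A))" for I :: "'i set"
    by (rule group.group_comm_groupI)
      (auto simp: A.group_axioms PiE_iff intro!: restrict_ext A.m_comm)
  interpret C1: comm_group "cochains1 G A" unfolding cochains1_def by (rule comm)
  interpret C2: comm_group "cochains2 G A" unfolding cochains2_def by (rule comm)
  interpret C3: comm_group "cochains3 G A" unfolding cochains3_def by (rule comm)
  interpret d1: group_hom "cochains1 G A" "cochains2 G A" "diff1 G A"
    by unfold_locales
      (auto simp: hom_def cochains1_def cochains2_def diff1_def PiE_iff A.inv_mult A.m_ac
        intro!: restrict_ext)
  interpret d2: group_hom "cochains2 G A" "cochains3 G A" "diff2 G A"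
    by unfold_locales
      (auto simp: hom_def cochains2_def cochains3_def diff2_def PiE_iff A.inv_mult A.m_ac
        intro!: restrict_ext)
  have dd: "diff2 G A (diff1 G A f) = \<one>\<^bsub>cochains3 G A\<^esub>" if "f \<in> carrier (cochains1 G A)" for f
  proof -
    have f: "f x \<in> carrier A" if "x \<in> carrier G" for x
      using \<open>f \<in> carrier (cochains1 G A)\<close> that by (auto simp: cochains1_def)
    have shuffle: "(z \<otimes>\<^bsub>A\<^esub> inv\<^bsub>A\<^esub> yz \<otimes>\<^bsub>A\<^esub> y) \<otimes>\<^bsub>A\<^esub> inv\<^bsub>A\<^esub> (z \<otimes>\<^bsub>A\<^esub> inv\<^bsub>A\<^esub> xyz \<otimes>\<^bsub>A\<^esub> xy)
        \<otimes>\<^bsub>A\<^esub> (yz \<otimes>\<^bsub>A\<^esub> inv\<^bsub>A\<^esub> xyz \<otimes>\<^bsub>A\<^esub> x) \<otimes>\<^bsub>A\<^esub> inv\<^bsub>A\<^esub> (y \<otimes>\<^bsub>A\<^esub> inv\<^bsub>A\<^esub> xy \<otimes>\<^bsub>A\<^esub> x) = \<one>\<^bsub>A\<^esub>" (is "?lhs = _")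
      if [simp]: "x \<in> carrier A" "y \<in> carrier A" "z \<in> carrier A"
        "xy \<in> carrier A" "yz \<in> carrier A" "xyz \<in> carrier A" for x y z xy yz xyz
    proof -
      have "?lhs = (z \<otimes>\<^bsub>A\<^esub> inv\<^bsub>A\<^esub> z) \<otimes>\<^bsub>A\<^esub> ((y \<otimes>\<^bsub>A\<^esub> inv\<^bsub>A\<^esub> y) \<otimes>\<^bsub>A\<^esub> ((x \<otimes>\<^bsub>A\<^esub> inv\<^bsub>A\<^esub> x) \<otimes>\<^bsub>A\<^esub>
          ((xy \<otimes>\<^bsub>A\<^esub> inv\<^bsub>A\<^esub> xy) \<otimes>\<^bsub>A\<^esub> ((yz \<otimes>\<^bsub>A\<^esub> inv\<^bsub>A\<^esub> yz) \<otimes>\<^bsub>A\<^esub> (xyz \<otimes>\<^bsub>A\<^esub> inv\<^bsub>A\<^esub> xyz)))))"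
        by (simp add: A.inv_mult A.m_ac del: A.r_inv A.Units_r_inv)
      also have "\<dots> = \<one>\<^bsub>A\<^esub>"
        by simp
      finally show ?thesis .
    qed
    show ?thesis
      by (auto simp: diff2_def diff1_def cochains3_def G.m_assoc f shuffle intro!: restrict_ext)
  qed
  have ker: "subgroup (kernel (cochains2 G A) (cochains3 G A) (diff2 G A)) (cochains2 G A)"
    by (rule d2.subgroup_kernel)
  have "coboundaries2 G A \<subseteq> kernel (cochains2 G A) (cochains3 G A) (diff2 G A)"
    using dd d1.hom_closed by (auto simp: coboundaries2_def kernel_def)
  then have "subgroup (coboundaries2 G A) (cocycles2 G A)"
    unfolding cocycles2_def using ker d1.img_is_subgroup
    by (auto simp: coboundaries2_def intro: C2.subgroup_incl)
  moreover have "comm_group (cocycles2 G A)"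
    unfolding cocycles2_def
    by (rule group.group_comm_groupI[OF C2.subgroup_imp_group[OF ker]])
      (auto simp: kernel_def intro: C2.m_comm)
  ultimately show ?thesis
    unfolding H2_def by (simp add: comm_group.subgroup_imp_normal normal.factorgroup_is_group)
qed

end

theory Submission
  imports Defs
    "HOL-Computational_Algebra.Fundamental_Theorem_Algebra"
    "HOL-Analysis.Continuum_Not_Denumerable"
begin

text \<open>The easy direction is a direct computation. For the other one, let \<open>\<rho>\<close> be an irreducible
  quandle representation of \<open>Conj G\<close>. Conjugation by \<open>\<rho> x \<circ> \<rho> y\<close> and conjugation by \<open>\<rho> (x \<otimes> y)\<close>
  both send \<open>\<rho> z\<close> to the value of \<open>\<rho>\<close> at the conjugate of \<open>z\<close> by \<open>x \<otimes> y\<close>, so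
  \<open>\<rho> (x \<otimes> y)\<inverse> \<circ> \<rho> x \<circ> \<rho> y\<close> commutes with every \<open>\<rho> z\<close>. By Schur's lemma it is a scalar \<open>c (x, y)\<close>,
  which means that \<open>\<rho>\<close> is a projective representation of the group \<open>G\<close>
  (\<open>irreducible_quandle_representation_projective\<close>). Associativity makes \<open>c\<close> a 2-cocycle with values
  in the nonzero complex numbers. Since the second cohomology group is trivial, \<open>c\<close> is the
  coboundary of some \<open>f\<close> (\<open>complex_cocycle_split\<close>); dividing \<open>\<rho>\<close> by \<open>f\<close> gives a linear representation \<open>\<rho>'\<close> with the same
  invariant subspaces. With \<open>z\<close> the conjugate of \<open>y\<close> by \<open>x\<close>, the quandle relation
  \<open>\<rho> z \<circ> \<rho> x = \<rho> x \<circ> \<rho> y\<close> gives \<open>c (z, x) = c (x, y)\<close>, and hence \<open>f z = f y\<close>: the factor \<open>f\<close> is a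
  quandle character.

  The representation space is not assumed to be finite-dimensional, and finiteness of \<open>G\<close> does not
  give this at once, as the operators \<open>\<rho> x\<close> may generate an infinite group. Schur's lemma is
  therefore proved in Dixmier's form (\<open>schur_countable\<close>), which only needs that countably many
  operators act. Then the space has countable dimension, being spanned by the images of one nonzero
  vector \<open>u\<close> under all words in the operators. An operator \<open>T\<close> in the commutant that is not a scalar
  has a bijective \<open>T - \<lambda>\<close> for every \<open>\<lambda>\<close>, and the uncountably many vectors \<open>(T - \<lambda>)\<inverse> u\<close> are linearly
  independent, which is a contradiction.\<close>

section \<open>Polynomials in a linear operator\<close>

text \<open>The vector \<open>p(T) v\<close>, evaluated by Horner's scheme.\<close>

definition poly_apply ::
  "('a::comm_ring_1 \<Rightarrow> 'v \<Rightarrow> 'v::ab_group_add) \<Rightarrow> ('v \<Rightarrow> 'v) \<Rightarrow> 'a poly \<Rightarrow> 'v \<Rightarrow> 'v" where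
  "poly_apply scale T p v = fold_coeffs (\<lambda>a w. scale a v + T w) p 0"

context vector_space
begin

context
  fixes T
  assumes T: "Vector_Spaces.linear scale scale T"
begin

interpretation T: Vector_Spaces.linear scale scale T by (fact T)

lemma poly_apply_0 [simp]: "poly_apply scale T 0 v = 0"
  by (simp add: poly_apply_def)

lemma poly_apply_pCons [simp]:
  "poly_apply scale T (pCons a p) v = scale a v + T (poly_apply scale T p v)"
  by (cases "p = 0"; cases "a = 0") (simp_all add: poly_apply_def T.zero)

lemma poly_apply_add:
  "poly_apply scale T (p + q) v = poly_apply scale T p v + poly_apply scale T q v"
  by (induction p q rule: poly_induct2) (simp_all add: T.add scale_left_distrib algebra_simps)

lemma poly_apply_smult: "poly_apply scale T (smult a p) v = scale a (poly_apply scale T p v)"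
  by (induction p) (simp_all add: T.scale scale_right_distrib)

lemma poly_apply_sum:
  "poly_apply scale T (\<Sum>i\<in>I. p i) v = (\<Sum>i\<in>I. poly_apply scale T (p i) v)"
  by (induction I rule: infinite_finite_induct) (simp_all add: poly_apply_add)

lemma poly_apply_mult:
  "poly_apply scale T (p * q) v = poly_apply scale T p (poly_apply scale T q v)"
  by (induction p) (simp_all add: poly_apply_add poly_apply_smult)

lemma poly_apply_vec_add:
  "poly_apply scale T p (v + w) = poly_apply scale T p v + poly_apply scale T p w"
  by (induction p) (simp_all add: T.add scale_right_distrib algebra_simps)

lemma poly_apply_vec_scale: "poly_apply scale T p (scale a v) = scale a (poly_apply scale T p v)"
  by (induction p) (simp_all add: T.scale scale_right_distrib mult.commute)

lemma poly_apply_vec_zero: "poly_apply scale T p 0 = 0"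
  using poly_apply_vec_scale[of p 0 0] by simp

lemma poly_apply_vec_sum:
  "poly_apply scale T p (\<Sum>i\<in>I. v i) = (\<Sum>i\<in>I. poly_apply scale T p (v i))"
  by (induction I rule: infinite_finite_induct)
    (simp_all add: poly_apply_vec_add poly_apply_vec_zero)

end

section \<open>Schur's lemma in countable dimension\<close>

lemma countable_independent_span:
  assumes B: "countable B" and S: "independent S" "S \<subseteq> span B"
  shows "countable S"
proof -
  have "S \<subseteq> (\<Union>F\<in>{F. finite F \<and> F \<subseteq> B}. S \<inter> span F)"
  proof
    fix s assume "s \<in> S"
    then obtain t r where "finite t" "t \<subseteq> B" "s = (\<Sum>a\<in>t. scale (r a) a)"
      using S(2) unfolding span_explicit by blast
    then have "s \<in> span t"
      by (simp add: span_sum span_scale span_base)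
    then show "s \<in> (\<Union>F\<in>{F. finite F \<and> F \<subseteq> B}. S \<inter> span F)"
      using \<open>s \<in> S\<close> \<open>finite t\<close> \<open>t \<subseteq> B\<close> by blast
  qed
  moreover have "finite (S \<inter> span F)" if "finite F" for F
    using independent_span_bound[OF that, of "S \<inter> span F"] independent_mono[OF S(1)] by auto
  then have "countable (\<Union>F\<in>{F. finite F \<and> F \<subseteq> B}. S \<inter> span F)"
    using countable_Collect_finite_subset[OF B] by (intro countable_UN) (auto intro: countable_finite)
  ultimately show ?thesis
    by (rule countable_subset)
qed

end

lemma poly_apply_eq_0_iff:
  fixes scale :: "complex \<Rightarrow> 'v::ab_group_add \<Rightarrow> 'v"
  assumes "vector_space scale" and T: "Vector_Spaces.linear scale scale T"
    and noeig: "\<And>c v. T v = scale c v \<Longrightarrow> v = 0"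
    and "p \<noteq> 0"
  shows "poly_apply scale T p v = 0 \<longleftrightarrow> v = 0"
proof -
  interpret vector_space scale by fact
  interpret T: Vector_Spaces.linear scale scale T by fact
  have "poly_apply scale T p v \<noteq> 0" if "v \<noteq> 0" using \<open>p \<noteq> 0\<close> that
  proof (induction "degree p" arbitrary: p v)
    case 0
    then obtain a where "p = [:a:]" "a \<noteq> 0"
      by (metis degree_eq_zeroE pCons_eq_0_iff)
    then show ?case using 0 T by (simp add: T.zero)
  next
    case (Suc n)
    then have "\<not> constant (poly p)"
      by (metis constant_degree nat.distinct(1))
    then obtain c where "poly p c = 0"
      using fundamental_theorem_of_algebra by blast
    then obtain q where q: "p = [:- c, 1:] * q"
      by (metis dvdE poly_eq_0_iff_dvd)
    then have "q \<noteq> 0"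
      using Suc.prems(1) by auto
    then have "n = degree q"
      using Suc.hyps(2) unfolding q by (subst (asm) degree_mult_eq) auto
    have "T v - scale c v \<noteq> 0"
      using noeig[of v c] Suc.prems by auto
    with \<open>n = degree q\<close> \<open>q \<noteq> 0\<close> have "poly_apply scale T q (T v - scale c v) \<noteq> 0"
      by (rule Suc.hyps(1))
    moreover have "p = q * [:- c, 1:]"
      by (simp add: q)
    ultimately show ?case
      using poly_apply_mult[OF T, of q "[:- c, 1:]" v] T by (simp add: T.zero)
  qed
  then show ?thesis
    using poly_apply_vec_zero[OF T] by blast
qed

text \<open>The vector \<open>r c\<close> stands for \<open>(T - c)\<inverse> u\<close>. A vanishing combination of such vectors becomes, after clearing the denominators
  \<open>T - \<lambda>\<close>, a relation \<open>q(T) u = 0\<close> with a nonzero polynomial \<open>q\<close>.\<close>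

lemma independent_resolvents:
  fixes scale :: "complex \<Rightarrow> 'v::ab_group_add \<Rightarrow> 'v"
  assumes "vector_space scale" and T: "Vector_Spaces.linear scale scale T"
    and noeig: "\<And>c v. T v = scale c v \<Longrightarrow> v = 0"
    and "u \<noteq> 0" and r: "\<And>c. T (r c) - scale c (r c) = u"
  shows "inj r" and "module.independent scale (range r)"
proof -
  interpret vector_space scale by fact
  interpret T: Vector_Spaces.linear scale scale T by fact
  show inj: "inj r"
  proof (rule injI)
    fix a b assume eq: "r a = r b"
    have "r a \<noteq> 0"
      using r[of a] \<open>u \<noteq> 0\<close> by (auto simp: T.zero)
    moreover have "scale a (r a) = scale b (r a)"
      using r[of a] r[of b] eq by (metis diff_left_imp_eq)
    ultimately show "a = b"
      by simp
  qed
  show "independent (range r)"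
    unfolding independent_explicit_module
  proof (intro allI impI)
    fix t g w
    assume "finite t" "t \<subseteq> range r" and sum0: "(\<Sum>v\<in>t. scale (g v) v) = 0" and "w \<in> t"
    then obtain L where L: "t = r ` L" "finite L"
      using finite_subset_image by metis
    then obtain l where l: "l \<in> L" "w = r l"
      using \<open>w \<in> t\<close> by blast
    define P where "P M = (\<Prod>c\<in>M. [:- c, 1:])" for M :: "complex set"
    define q where "q = (\<Sum>c\<in>L. smult (g (r c)) (P (L - {c})))"
    have step: "poly_apply scale T (P L) (r c) = poly_apply scale T (P (L - {c})) u" if "c \<in> L" for c
    proof -
      have "P L = P (L - {c}) * [:- c, 1:]"
        using prod.remove[OF L(2) that, of "\<lambda>c. [:- c, 1:]"] by (simp add: P_def)
      then show ?thesis
        using r[of c] by (simp add: poly_apply_mult[OF T] poly_apply_pCons[OF T] poly_apply_0[OF T] T.zero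
              del: mult_pCons_right)
    qed
    have "poly_apply scale T q u = (\<Sum>c\<in>L. scale (g (r c)) (poly_apply scale T (P L) (r c)))"
      by (simp add: q_def poly_apply_sum[OF T] poly_apply_smult[OF T] step)
    also have "\<dots> = poly_apply scale T (P L) (\<Sum>c\<in>L. scale (g (r c)) (r c))"
      by (simp add: poly_apply_vec_sum[OF T] poly_apply_vec_scale[OF T])
    also have "(\<Sum>c\<in>L. scale (g (r c)) (r c)) = 0"
      using sum0 unfolding L by (subst (asm) sum.reindex) (auto intro: inj_on_subset[OF inj])
    finally have "poly_apply scale T q u = 0"
      by (simp add: poly_apply_vec_zero[OF T])
    moreover have "poly_apply scale T q u = 0 \<longleftrightarrow> u = 0" if "q \<noteq> 0"
      by (rule poly_apply_eq_0_iff[OF assms(1) T _ that]) (rule noeig)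
    ultimately have "q = 0"
      using \<open>u \<noteq> 0\<close> by blast
    \<comment> \<open>Evaluated at \<open>l\<close>, every summand of \<open>q\<close> but the one of index \<open>l\<close> vanishes.\<close>
    have "0 = poly q l"
      by (simp add: \<open>q = 0\<close>)
    also have "\<dots> = (\<Sum>c\<in>L. g (r c) * (\<Prod>d\<in>L - {c}. l - d))"
      by (simp add: q_def P_def poly_sum poly_prod)
    also have "\<dots> = g (r l) * (\<Prod>d\<in>L - {l}. l - d)"
      using L l by (subst sum.remove[OF L(2) l(1)]) (auto intro!: sum.neutral)
    finally show "g w = 0"
      using L l by auto
  qed
qed

text \<open>The invariant subspace generated by a vector \<open>u\<close> is spanned by its images under
  all words in the operators \<open>\<rho> x\<close>.\<close>

lemma subrepresentation_span_words:
  assumes "vector_space scale"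
    and lin: "\<And>x. x \<in> X \<Longrightarrow> Vector_Spaces.linear scale scale (\<rho> x)"
  shows "subrepresentation X scale \<rho> (module.span scale ((\<lambda>xs. foldr \<rho> xs u) ` lists X))"
proof -
  interpret vector_space scale by fact
  show ?thesis
    unfolding subrepresentation_def
  proof (intro conjI ballI)
    fix x assume x: "x \<in> X"
    interpret L: Vector_Spaces.linear scale scale "\<rho> x" by (rule lin[OF x])
    have "\<rho> x ` (\<lambda>xs. foldr \<rho> xs u) ` lists X \<subseteq> (\<lambda>xs. foldr \<rho> xs u) ` lists X"
      unfolding image_image
    proof (rule image_subsetI)
      fix xs assume "xs \<in> lists X"
      then show "\<rho> x (foldr \<rho> xs u) \<in> (\<lambda>xs. foldr \<rho> xs u) ` lists X"
        using x by (intro image_eqI[of _ _ "x # xs"]) auto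
    qed
    then show "\<rho> x ` span ((\<lambda>xs. foldr \<rho> xs u) ` lists X)
        \<subseteq> span ((\<lambda>xs. foldr \<rho> xs u) ` lists X)"
      unfolding L.span_image[symmetric] by (rule span_mono)
  qed simp
qed

text \<open>Dixmier's form of Schur's lemma: irreducibility under countably many operators is enough for the
  commutant to consist of scalars, in any dimension.\<close>

theorem schur_countable:
  fixes scale :: "complex \<Rightarrow> 'v::ab_group_add \<Rightarrow> 'v"
  assumes "vector_space scale" and X: "countable X"
    and lin: "\<And>x. x \<in> X \<Longrightarrow> Vector_Spaces.linear scale scale (\<rho> x)"
    and irred: "\<And>W. subrepresentation X scale \<rho> W \<Longrightarrow> W = {0} \<or> W = UNIV"
    and T: "Vector_Spaces.linear scale scale T"
    and comm: "\<And>x v. x \<in> X \<Longrightarrow> T (\<rho> x v) = \<rho> x (T v)"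
  obtains c where "\<And>v. T v = scale c v"
proof (rule ccontr)
  assume "\<not> thesis"
  then have nonscalar: "\<exists>v. T v \<noteq> scale c v" for c
    using that by blast
  interpret vector_space scale by fact
  interpret T: Vector_Spaces.linear scale scale T by fact
  have rho: "\<rho> x 0 = 0" "\<rho> x (v + w) = \<rho> x v + \<rho> x w" "\<rho> x (v - w) = \<rho> x v - \<rho> x w"
    "\<rho> x (scale c v) = scale c (\<rho> x v)" if "x \<in> X" for x v w c
  proof -
    interpret L: Vector_Spaces.linear scale scale "\<rho> x" by (rule lin[OF that])
    show "\<rho> x 0 = 0" "\<rho> x (v + w) = \<rho> x v + \<rho> x w" "\<rho> x (v - w) = \<rho> x v - \<rho> x w"
      "\<rho> x (scale c v) = scale c (\<rho> x v)"
      by (rule L.zero L.add L.diff L.scale)+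
  qed
  \<comment> \<open>Kernel and range of \<open>T - c\<close> are invariant, so \<open>T - c\<close> is injective and surjective.\<close>
  have noeig: "v = 0" if "T v = scale c v" for c v
  proof -
    have "subspace {v. T v = scale c v}"
      by (simp add: subspace_def T.zero T.add T.scale scale_right_distrib mult.commute)
    then have "subrepresentation X scale \<rho> {v. T v = scale c v}"
      by (simp add: subrepresentation_def image_subset_iff comm rho)
    then have "{v. T v = scale c v} = {0}"
      using irred nonscalar[of c] by blast
    then show ?thesis
      using that by blast
  qed
  obtain u :: 'v where u: "u \<noteq> 0"
    using nonscalar[of 0] T.zero by fastforce
  have "\<exists>w. T w - scale c w = u" for c
  proof -
    let ?R = "range (\<lambda>w. T w - scale c w)"
    have "subspace ?R"
    proof (rule subspaceI)
      show "0 \<in> ?R"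
        by (rule range_eqI[of _ _ 0]) (simp add: T.zero)
      show "v + w \<in> ?R" if "v \<in> ?R" "w \<in> ?R" for v w
      proof -
        from that obtain v' w' where "v = T v' - scale c v'" "w = T w' - scale c w'" by blast
        then show ?thesis
          by (intro range_eqI[of _ _ "v' + w'"]) (simp add: T.add scale_right_distrib)
      qed
      show "scale a v \<in> ?R" if "v \<in> ?R" for a v
      proof -
        from that obtain v' where "v = T v' - scale c v'" by blast
        then show ?thesis
          by (intro range_eqI[of _ _ "scale a v'"])
            (simp add: T.scale scale_right_diff_distrib mult.commute)
      qed
    qed
    moreover have "\<rho> x ` ?R \<subseteq> ?R" if "x \<in> X" for x
    proof (rule image_subsetI)
      fix v assume "v \<in> ?R"
      then obtain w where "v = T w - scale c w"
        by blast
      then have "\<rho> x v = T (\<rho> x w) - scale c (\<rho> x w)"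
        using that by (simp add: rho comm)
      then show "\<rho> x v \<in> ?R"
        by (rule range_eqI)
    qed
    ultimately have "subrepresentation X scale \<rho> ?R"
      by (simp add: subrepresentation_def)
    moreover have "T u - scale c u \<noteq> 0"
      using noeig[of u c] u by auto
    then have "?R \<noteq> {0}"
      by blast
    ultimately have "?R = UNIV"
      using irred by blast
    then have "u \<in> ?R"
      by simp
    then show ?thesis
      by (elim rangeE) (rule exI, rule sym)
  qed
  then obtain r where r: "\<And>c. T (r c) - scale c (r c) = u"
    by metis
  have ind: "inj r" "independent (range r)"
    by (rule independent_resolvents[OF assms(1) T _ u r], rule noeig, assumption)+
  let ?B = "(\<lambda>xs. foldr \<rho> xs u) ` lists X"
  have "u \<in> ?B"
    by (rule image_eqI[of _ _ "[]"]) auto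
  then have "u \<in> span ?B"
    by (rule span_base)
  then have "span ?B \<noteq> {0}"
    using u by auto
  moreover have "subrepresentation X scale \<rho> (span ?B)"
    using assms(1) lin by (rule subrepresentation_span_words)
  then have "span ?B = {0} \<or> span ?B = UNIV"
    by (rule irred)
  ultimately have "span ?B = UNIV"
    by simp
  moreover have "countable ?B"
    using X by simp
  ultimately have "countable (range r)"
    using countable_independent_span[OF _ ind(2), of ?B] by simp
  then have "countable (UNIV :: complex set)"
    using ind(1) by (simp add: countable_image_inj_eq)
  then have "countable (range complex_of_real)"
    by (rule countable_subset[rotated]) simp
  then show False
    using uncountable_UNIV_real by (simp add: countable_image_inj_eq inj_of_real)
qed

section \<open>Cocycles\<close>

lemma coboundary_if_H2_trivial:
  assumes "group G" and "comm_group A" and triv: "trivial_group (H2 G A)"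
    and z: "z \<in> carrier (cocycles2 G A)"
  shows "z \<in> coboundaries2 G A"
proof -
  interpret G: group G by fact
  interpret A: comm_group A by fact
  let ?B = "coboundaries2 G A"
  have "?B #>\<^bsub>cocycles2 G A\<^esub> z \<in> carrier (H2 G A)"
    using z by (auto simp: H2_def FactGroup_def RCOSETS_def)
  then have coset: "?B #>\<^bsub>cocycles2 G A\<^esub> z = ?B"
    using triv by (simp add: trivial_group_def H2_def FactGroup_def)
  have one: "\<one>\<^bsub>cochains2 G A\<^esub> \<in> ?B"
    unfolding coboundaries2_def
    by (rule image_eqI[of _ _ "\<one>\<^bsub>cochains1 G A\<^esub>"])
      (auto simp: diff1_def cochains1_def cochains2_def intro!: restrict_ext)
  have zC: "z \<in> carrier (cochains2 G A)"
    using z by (simp add: cocycles2_def kernel_def)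
  have "\<one>\<^bsub>cochains2 G A\<^esub> \<otimes>\<^bsub>cochains2 G A\<^esub> z = z"
    using zC by (intro monoid.l_one group.is_monoid) (auto simp: cochains2_def A.group_axioms)
  then have "z \<in> ?B #>\<^bsub>cocycles2 G A\<^esub> z"
    using one by (force simp: r_coset_def cocycles2_def)
  then show ?thesis
    by (simp add: coset)
qed

lemma inv_complex_mult_group:
  "x \<noteq> 0 \<Longrightarrow> inv\<^bsub>complex_mult_group\<^esub> x = inverse x"
  by (rule group.inv_equality[OF comm_group.axioms(2)[OF comm_group_complex_mult_group]])
    (auto simp: complex_mult_group_def)

text \<open>Every nowhere vanishing 2-cocycle \<open>c\<close> is trivialised by a function \<open>f\<close>. The relation is stated
  without inverses.\<close>

lemma complex_cocycle_split:
  fixes G (structure) and c :: "'g \<Rightarrow> 'g \<Rightarrow> complex"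
  assumes "group G" and triv: "trivial_group (H2 G complex_mult_group)"
    and nz: "\<And>x y. \<lbrakk>x \<in> carrier G; y \<in> carrier G\<rbrakk> \<Longrightarrow> c x y \<noteq> 0"
    and cocycle: "\<And>x y z. \<lbrakk>x \<in> carrier G; y \<in> carrier G; z \<in> carrier G\<rbrakk>
      \<Longrightarrow> c x y * c (x \<otimes> y) z = c y z * c x (y \<otimes> z)"
  obtains f where "\<And>x. x \<in> carrier G \<Longrightarrow> f x \<noteq> 0"
    and "\<And>x y. \<lbrakk>x \<in> carrier G; y \<in> carrier G\<rbrakk> \<Longrightarrow> f x * f y = c x y * f (x \<otimes> y)"
proof -
  interpret G: group G by fact
  let ?A = complex_mult_group
  define z where "z = (\<lambda>(x, y) \<in> carrier G \<times> carrier G. c x y)"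
  have mult: "a \<otimes>\<^bsub>?A\<^esub> b = a * b" and one: "\<one>\<^bsub>?A\<^esub> = 1"
    and carr: "a \<in> carrier ?A \<longleftrightarrow> a \<noteq> 0" for a b
    by (simp_all add: complex_mult_group_def)
  have "z \<in> carrier (cochains2 G ?A)"
    using nz by (auto simp: cochains2_def z_def carr)
  moreover have "diff2 G ?A z = \<one>\<^bsub>cochains3 G ?A\<^esub>"
    using nz cocycle
    by (auto simp: diff2_def cochains3_def z_def mult one inv_complex_mult_group field_simps
        intro!: restrict_ext)
  ultimately have "z \<in> carrier (cocycles2 G ?A)"
    by (simp add: cocycles2_def kernel_def)
  then have "z \<in> coboundaries2 G ?A"
    by (rule coboundary_if_H2_trivial[OF assms(1) comm_group_complex_mult_group triv])
  then obtain f where f: "f \<in> carrier (cochains1 G ?A)" and zf: "z = diff1 G ?A f"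
    unfolding coboundaries2_def by blast
  have nz': "f x \<noteq> 0" if "x \<in> carrier G" for x
    using f that by (auto simp: cochains1_def PiE_iff carr)
  show thesis
  proof (rule that)
    show "f x * f y = c x y * f (x \<otimes> y)" if "x \<in> carrier G" "y \<in> carrier G" for x y
      using fun_cong[OF zf, of "(x, y)"] that nz'[of "x \<otimes> y"]
      by (simp add: z_def diff1_def mult inv_complex_mult_group field_simps)
  qed (rule nz')
qed

section \<open>Twisting by scalars\<close>

lemma subrepresentation_cong:
  "(\<And>x. x \<in> X \<Longrightarrow> \<rho> x = \<sigma> x) \<Longrightarrow> subrepresentation X scale \<rho> W \<longleftrightarrow> subrepresentation X scale \<sigma> W"
  by (simp add: subrepresentation_def)

lemma subrepresentation_twist:
  assumes "vector_space scale" and nz: "\<And>x. x \<in> X \<Longrightarrow> \<chi> x \<noteq> 0"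
  shows "subrepresentation X scale (twist scale \<chi> \<rho>) W \<longleftrightarrow> subrepresentation X scale \<rho> W"
proof -
  interpret vector_space scale by fact
  have "scale c v \<in> W \<longleftrightarrow> v \<in> W" if "subspace W" "c \<noteq> 0" for c v
    using subspace_scale[OF that(1), of v c] subspace_scale[OF that(1), of "scale c v" "inverse c"] that
    by auto
  then show ?thesis
    using nz by (auto simp: subrepresentation_def twist_def image_subset_iff)
qed

lemma twist_in_GL:
  assumes "vector_space scale" and "\<rho> x \<in> carrier (GL scale)" and "\<chi> x \<noteq> 0"
  shows "twist scale \<chi> \<rho> x \<in> carrier (GL scale)"
proof -
  interpret vector_space scale by fact
  interpret L: Vector_Spaces.linear scale scale "\<rho> x"
    using assms(2) by (simp add: GL_def)
  have "Vector_Spaces.linear scale scale (\<lambda>v. scale (\<chi> x) (\<rho> x v))"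
    by unfold_locales (simp_all add: L.add L.scale scale_right_distrib mult.commute)
  moreover have "bij (scale (\<chi> x))"
    using assms(3) by (intro bij_betw_byWitness[where f' = "scale (inverse (\<chi> x))"]) auto
  then have "bij (\<lambda>v. scale (\<chi> x) (\<rho> x v))"
    using assms(2) bij_comp[of "\<rho> x" "scale (\<chi> x)"] by (simp add: GL_def o_def)
  ultimately show ?thesis
    by (simp add: GL_def twist_def)
qed

lemma group_representation_apply_mult:
  assumes "group_representation G scale \<rho>" and "x \<in> carrier G" "y \<in> carrier G"
  shows "\<rho> (x \<otimes>\<^bsub>G\<^esub> y) v = \<rho> x (\<rho> y v)"
  using hom_mult[OF group_representation.rep_hom[OF assms(1)] assms(2,3)]
  by (simp add: GL_def)

section \<open>Quandle representations of conjugation quandles\<close>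

lemma (in quandle_representation) apply_qop:
  assumes "x \<in> carrier Q" "y \<in> carrier Q"
  shows "\<rho> (x \<triangleright> y) (\<rho> x v) = \<rho> x (\<rho> y v)"
proof -
  interpret GL: group "GL scale"
    by (rule group_GL) unfold_locales
  have "\<rho> (x \<triangleright> y) \<otimes>\<^bsub>GL scale\<^esub> \<rho> x = \<rho> x \<otimes>\<^bsub>GL scale\<^esub> \<rho> y"
    using rep_closed assms by (simp add: rep_qop GL.m_assoc)
  then show ?thesis
    by (simp add: GL_def fun_eq_iff)
qed

text \<open>Irreducible representations of \<open>Conj G\<close> are projective representations of \<open>G\<close>. No hypothesis on
  the cohomology of \<open>G\<close> is needed here, and countability of \<open>G\<close> is only used for Schur's lemma.\<close>

lemma irreducible_quandle_representation_projective:
  fixes G (structure)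
  assumes "group G" and count: "countable (carrier G)"
    and rep: "irreducible_quandle_representation (Conj G) scale \<rho>"
    and x: "x \<in> carrier G" and y: "y \<in> carrier G"
  obtains c where "c \<noteq> 0" and "\<And>v. \<rho> x (\<rho> y v) = scale c (\<rho> (x \<otimes> y) v)"
proof -
  interpret G: group G by fact
  interpret irreducible_quandle_representation "Conj G" scale \<rho> by fact
  interpret GL: group "GL scale"
    by (rule group_GL) unfold_locales
  have carr: "carrier (Conj G) = carrier G"
    by (simp add: Conj_def)
  have closed: "\<rho> z \<in> carrier (GL scale)" if "z \<in> carrier G" for z
    using rep_closed that by (simp add: carr)
  have lin: "Vector_Spaces.linear scale scale (\<rho> z)" and inj: "inj (\<rho> z)"
    if "z \<in> carrier G" for z
    using closed[OF that] by (simp_all add: GL_def bij_is_inj)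
  have conj: "\<rho> (a \<otimes> b \<otimes> inv a) (\<rho> a v) = \<rho> a (\<rho> b v)"
    if "a \<in> carrier G" "b \<in> carrier G" for a b v
    using apply_qop[of a b v] that by (simp add: Conj_def)
  have xy: "x \<otimes> y \<in> carrier G"
    using x y by simp
  \<comment> \<open>This operator measures how far \<open>\<rho>\<close> is from being multiplicative at \<open>(x, y)\<close>; it will be scalar.\<close>
  define T where "T = inv\<^bsub>GL scale\<^esub> \<rho> (x \<otimes> y) \<otimes>\<^bsub>GL scale\<^esub> (\<rho> x \<otimes>\<^bsub>GL scale\<^esub> \<rho> y)"
  have TGL: "T \<in> carrier (GL scale)"
    using closed x y by (simp add: T_def)
  have "\<rho> (x \<otimes> y) \<otimes>\<^bsub>GL scale\<^esub> T = \<rho> x \<otimes>\<^bsub>GL scale\<^esub> \<rho> y"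
    using closed x y by (simp add: T_def flip: GL.m_assoc)
  then have T: "\<rho> (x \<otimes> y) (T v) = \<rho> x (\<rho> y v)" for v
    by (simp add: GL_def fun_eq_iff)
  have comm: "T (\<rho> z v) = \<rho> z (T v)" if z: "z \<in> carrier G" for z v
  proof (rule injD[OF inj[OF xy]])
    \<comment> \<open>Conjugating by \<open>y\<close> and then by \<open>x\<close> is conjugating by \<open>x \<otimes> y\<close>.\<close>
    let ?w = "(x \<otimes> y) \<otimes> z \<otimes> inv (x \<otimes> y)"
    have w: "?w = x \<otimes> (y \<otimes> z \<otimes> inv y) \<otimes> inv x"
      using x y z by (simp add: G.m_assoc G.inv_mult_group)
    have "\<rho> (x \<otimes> y) (T (\<rho> z v)) = \<rho> x (\<rho> y (\<rho> z v))"
      by (rule T)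
    also have "\<dots> = \<rho> x (\<rho> (y \<otimes> z \<otimes> inv y) (\<rho> y v))"
      using y z by (simp add: conj)
    also have "\<dots> = \<rho> ?w (\<rho> x (\<rho> y v))"
      unfolding w using x y z by (intro conj[symmetric]) auto
    also have "\<dots> = \<rho> ?w (\<rho> (x \<otimes> y) (T v))"
      by (simp only: T)
    also have "\<dots> = \<rho> (x \<otimes> y) (\<rho> z (T v))"
      by (rule conj[OF xy z])
    finally show "\<rho> (x \<otimes> y) (T (\<rho> z v)) = \<rho> (x \<otimes> y) (\<rho> z (T v))" .
  qed
  obtain c where c: "\<And>v. T v = scale c v"
  proof (rule schur_countable[of scale "carrier G" \<rho> T])
    show "Vector_Spaces.linear scale scale T"
      using TGL by (simp add: GL_def)
    show "W = {0} \<or> W = UNIV" if "subrepresentation (carrier G) scale \<rho> W" for W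
      using irreducible[of W] that by (simp add: carr)
  qed (use vector_space_axioms count lin comm that in auto)
  show thesis
  proof (rule that)
    interpret L: Vector_Spaces.linear scale scale "\<rho> (x \<otimes> y)" by (rule lin[OF xy])
    show "\<rho> x (\<rho> y v) = scale c (\<rho> (x \<otimes> y) v)" for v
      using T[of v] by (simp add: c L.scale)
    show "c \<noteq> 0"
    proof
      assume "c = 0"
      then have "T v = T 0" for v
        by (simp add: c)
      moreover have "inj T"
        using TGL by (simp add: GL_def bij_is_inj)
      ultimately show False
        using nonzero by (auto dest: injD)
    qed
  qed
qed

lemma irreducible_quandle_representation_twist:
  fixes G (structure)
    and scale :: "complex \<Rightarrow> 'v::ab_group_add \<Rightarrow> 'v"
  assumes \<chi>: "quandle_character (Conj G) \<chi>"
    and rep: "irreducible_group_representation G scale \<rho>'"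
    and eq: "\<And>x. x \<in> carrier G \<Longrightarrow> \<rho> x = twist scale \<chi> \<rho>' x"
  shows "irreducible_quandle_representation (Conj G) scale \<rho>"
proof -
  interpret irreducible_group_representation G scale \<rho>' by fact
  interpret GL: group "GL scale"
    by (rule group_GL) unfold_locales
  have nz: "\<chi> x \<noteq> 0" if "x \<in> carrier G" for x
    using \<chi> that by (simp add: quandle_character_def Conj_def)
  have \<chi>_conj: "\<chi> (x \<otimes> y \<otimes> inv x) = \<chi> y" if "x \<in> carrier G" "y \<in> carrier G" for x y
    using \<chi> that by (simp add: quandle_character_def Conj_def)
  have closed': "\<rho>' x \<in> carrier (GL scale)" if "x \<in> carrier G" for x
    using hom_in_carrier[OF rep_hom that] .
  then have closed: "\<rho> x \<in> carrier (GL scale)" if "x \<in> carrier G" for x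
    using that nz by (simp add: eq twist_in_GL vector_space_axioms)
  have scale': "\<rho>' x (scale c v) = scale c (\<rho>' x v)" if "x \<in> carrier G" for x c v
  proof -
    interpret L: Vector_Spaces.linear scale scale "\<rho>' x"
      using closed'[OF that] by (simp add: GL_def)
    show ?thesis by (rule L.scale)
  qed
  show ?thesis
  proof (intro irreducible_quandle_representation.intro quandle_representation.intro
      quandle_representation_axioms.intro irreducible_quandle_representation_axioms.intro)
    show "quandle (Conj G)" by (rule quandle_Conj)
    show "vector_space scale" by unfold_locales
    show "(UNIV :: 'v set) \<noteq> {0}" by (rule nonzero)
    show "\<rho> x \<in> carrier (GL scale)" if "x \<in> carrier (Conj G)" for x
      using that closed by (simp add: Conj_def)
    show "W = {0} \<or> W = UNIV" if "subrepresentation (carrier (Conj G)) scale \<rho> W" for W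
    proof (rule irreducible)
      show "subrepresentation (carrier G) scale \<rho>' W"
        using that subrepresentation_cong[of "carrier G" \<rho> "twist scale \<chi> \<rho>'" scale W] eq
          subrepresentation_twist[OF vector_space_axioms, of "carrier G" \<chi> \<rho>' W] nz
        by (simp add: Conj_def)
    qed
    fix x y assume "x \<in> carrier (Conj G)" "y \<in> carrier (Conj G)"
    then have xy: "x \<in> carrier G" "y \<in> carrier G"
      by (simp_all add: Conj_def)
    let ?z = "x \<otimes> y \<otimes> inv x"
    have "\<rho> ?z (\<rho> x v) = \<rho> x (\<rho> y v)" for v
    proof -
      have "\<rho> ?z (\<rho> x v) = scale (\<chi> y * \<chi> x) (\<rho>' (?z \<otimes> x) v)"
        using xy by (simp add: eq twist_def scale' \<chi>_conj
            group_representation_apply_mult[OF group_representation_axioms])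
      also have "?z \<otimes> x = x \<otimes> y"
        using xy by (simp add: m_assoc)
      also have "scale (\<chi> y * \<chi> x) (\<rho>' (x \<otimes> y) v) = \<rho> x (\<rho> y v)"
        using xy by (simp add: eq twist_def scale' mult.commute
            group_representation_apply_mult[OF group_representation_axioms])
      finally show ?thesis .
    qed
    then have "\<rho> ?z \<otimes>\<^bsub>GL scale\<^esub> \<rho> x = \<rho> x \<otimes>\<^bsub>GL scale\<^esub> \<rho> y"
      by (simp add: GL_def fun_eq_iff)
    then show "\<rho> (x \<triangleright>\<^bsub>Conj G\<^esub> y) = \<rho> x \<otimes>\<^bsub>GL scale\<^esub> \<rho> y \<otimes>\<^bsub>GL scale\<^esub> inv\<^bsub>GL scale\<^esub> \<rho> x"
      using closed xy by (simp add: Conj_def GL.inv_solve_right)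
  qed
qed

lemma irreducible_quandle_representation_untwist:
  fixes G (structure)
    and scale :: "complex \<Rightarrow> 'v::ab_group_add \<Rightarrow> 'v"
  assumes "group G" and count: "countable (carrier G)"
    and triv: "trivial_group (H2 G complex_mult_group)"
    and rep: "irreducible_quandle_representation (Conj G) scale \<rho>"
  shows "\<exists>\<chi> \<rho>'. quandle_character (Conj G) \<chi> \<and>
       irreducible_group_representation G scale \<rho>' \<and>
       (\<forall>x\<in>carrier G. \<rho> x = twist scale \<chi> \<rho>' x)"
proof -
  interpret G: group G by fact
  interpret irreducible_quandle_representation "Conj G" scale \<rho> by fact
  have carr: "carrier (Conj G) = carrier G"
    by (simp add: Conj_def)
  have closed: "\<rho> x \<in> carrier (GL scale)" if "x \<in> carrier G" for x
    using rep_closed that by (simp add: carr)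
  have lin: "\<rho> x (scale c v) = scale c (\<rho> x v)" "\<rho> x 0 = 0" if "x \<in> carrier G" for x c v
  proof -
    interpret L: Vector_Spaces.linear scale scale "\<rho> x"
      using closed[OF that] by (simp add: GL_def)
    show "\<rho> x (scale c v) = scale c (\<rho> x v)" "\<rho> x 0 = 0" by (rule L.scale L.zero)+
  qed
  obtain u :: 'v where "u \<noteq> 0"
    using nonzero by auto
  have nz: "\<rho> x u \<noteq> 0" if "x \<in> carrier G" for x
    using closed[OF that] lin(2)[OF that] \<open>u \<noteq> 0\<close> bij_is_inj[of "\<rho> x"] injD[of "\<rho> x" u 0]
    by (auto simp: GL_def)
  have "\<forall>x y. \<exists>c. x \<in> carrier G \<longrightarrow> y \<in> carrier G \<longrightarrow>
      c \<noteq> 0 \<and> (\<forall>v. \<rho> x (\<rho> y v) = scale c (\<rho> (x \<otimes> y) v))"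
    by (metis irreducible_quandle_representation_projective[OF assms(1) count rep])
  then obtain c where c0: "\<And>x y. \<lbrakk>x \<in> carrier G; y \<in> carrier G\<rbrakk> \<Longrightarrow> c x y \<noteq> 0"
    and c: "\<And>x y v. \<lbrakk>x \<in> carrier G; y \<in> carrier G\<rbrakk>
      \<Longrightarrow> \<rho> x (\<rho> y v) = scale (c x y) (\<rho> (x \<otimes> y) v)"
    by metis
  have "c x y * c (x \<otimes> y) z = c y z * c x (y \<otimes> z)"
    if [simp]: "x \<in> carrier G" "y \<in> carrier G" "z \<in> carrier G" for x y z
  proof -
    \<comment> \<open>Both sides are the scalar by which the triple composite differs from \<open>\<rho> (x \<otimes> y \<otimes> z)\<close>.\<close>
    have "scale (c x y * c (x \<otimes> y) z) (\<rho> (x \<otimes> y \<otimes> z) u) = \<rho> x (\<rho> y (\<rho> z u))"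
      by (simp add: c[of x y] c[of "x \<otimes> y" z])
    also have "\<dots> = scale (c y z * c x (y \<otimes> z)) (\<rho> (x \<otimes> y \<otimes> z) u)"
      by (simp add: c[of y z] c[of x "y \<otimes> z"] lin G.m_assoc)
    finally show ?thesis
      using nz[of "x \<otimes> y \<otimes> z"] by simp
  qed
  then obtain f where f0: "\<And>x. x \<in> carrier G \<Longrightarrow> f x \<noteq> 0"
    and f: "\<And>x y. \<lbrakk>x \<in> carrier G; y \<in> carrier G\<rbrakk> \<Longrightarrow> f x * f y = c x y * f (x \<otimes> y)"
    using complex_cocycle_split[OF assms(1) triv, of c] c0 by blast
  let ?r = "twist scale (\<lambda>x. inverse (f x)) \<rho>"
  have twist: "\<rho> x = twist scale f ?r x" if "x \<in> carrier G" for x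
    using f0[OF that] by (simp add: twist_def fun_eq_iff)
  have mult: "?r x (?r y v) = ?r (x \<otimes> y) v" if "x \<in> carrier G" "y \<in> carrier G" for x y v
  proof -
    have "inverse (f x) * (inverse (f y) * c x y) = inverse (f (x \<otimes> y))"
      using f[OF that] f0 c0[OF that] that by (simp add: field_simps)
    then show ?thesis
      using that by (simp add: twist_def lin c)
  qed
  have "irreducible_group_representation G scale ?r"
  proof (intro irreducible_group_representation.intro group_representation.intro
      group_representation_axioms.intro irreducible_group_representation_axioms.intro)
    show "?r \<in> hom G (GL scale)"
    proof (rule homI)
      show "?r x \<in> carrier (GL scale)" if "x \<in> carrier G" for x
        using that f0 by (intro twist_in_GL closed vector_space_axioms) auto
      show "?r (x \<otimes> y) = ?r x \<otimes>\<^bsub>GL scale\<^esub> ?r y" if "x \<in> carrier G" "y \<in> carrier G" for x y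
        using mult[OF that] by (simp add: GL_def fun_eq_iff)
    qed
    show "W = {0} \<or> W = UNIV" if "subrepresentation (carrier G) scale ?r W" for W
      using that irreducible[of W] f0
        subrepresentation_twist[OF vector_space_axioms, of "carrier G" "\<lambda>x. inverse (f x)" \<rho> W]
      by (simp add: carr)
  qed (use nonzero in \<open>auto intro: vector_space_axioms G.group_axioms\<close>)
  moreover have "quandle_character (Conj G) f"
    unfolding quandle_character_def carr
  proof (intro conjI ballI f0)
    fix x y assume xy [simp]: "x \<in> carrier G" "y \<in> carrier G"
    let ?z = "x \<otimes> y \<otimes> inv x"
    have zx: "?z \<otimes> x = x \<otimes> y"
      by (simp add: G.m_assoc)
    have "\<rho> ?z (\<rho> x u) = \<rho> x (\<rho> y u)"
      using apply_qop[of x y u] by (simp add: Conj_def)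
    then have "scale (c ?z x) (\<rho> (x \<otimes> y) u) = scale (c x y) (\<rho> (x \<otimes> y) u)"
      by (simp add: c zx)
    then have "c ?z x = c x y"
      using nz[of "x \<otimes> y"] by simp
    then have "f ?z * f x = f y * f x"
      using f[of ?z x] f[of x y] by (simp add: zx mult.commute)
    then show "f (x \<triangleright>\<^bsub>Conj G\<^esub> y) = f y"
      using f0[of x] by (simp add: Conj_def)
  qed
  ultimately show ?thesis
    using twist by blast
qed

theorem theorem2p13:
  fixes G (structure)
    and scale :: "complex \<Rightarrow> 'v::ab_group_add \<Rightarrow> 'v"
    and \<rho> :: "'g \<Rightarrow> 'v \<Rightarrow> 'v"
  assumes "group G"
    and "finite (carrier G)"
    and "trivial_group (H2 G complex_mult_group)"
    and "vector_space scale"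
  shows "irreducible_quandle_representation (Conj G) scale \<rho> \<longleftrightarrow>
    (\<exists>\<chi> \<rho>'. quandle_character (Conj G) \<chi> \<and>
       irreducible_group_representation G scale \<rho>' \<and>
       (\<forall>x\<in>carrier G. \<rho> x = twist scale \<chi> \<rho>' x))"
  using irreducible_quandle_representation_untwist[OF assms(1) countable_finite[OF assms(2)] assms(3)]
    irreducible_quandle_representation_twist[of G _ scale _ \<rho>]
  by blast

end
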